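(* Assume the Axiom of Choice. Let $X$ be a $T_1$-space. Then $\mathscr P(\mathsf{w}X)\cong\mathsf{w}\,\mathscr P(X)$ as MT-algebras, where $\mathsf{w}X$ is the classical Wallman extension of $X$ and $\mathsf{w}\,\mathscr P(X)$ is the Wallman extension of the MT-algebra $\mathscr P(X)$. Consequently, $\mathsf{w}X$ is homeomorphic to $\mathrm{at}(\mathsf{w}\,\mathscr P(X))$.
   Context: MT-algebras. An MT-algebra is a pair $(M,\square)$, where $M$ is a complete Boolean algebra and $\square:M\to M$ satisfies $\square 1=1$, $\square(a\wedge b)=\square a\wedge\square b$, $\square a\le a$, $\square a\le\square\square a$. Put $\Diamond a=\neg\square\neg a$. An element $a$ is open if $a=\square a$ and closed if $a=\Diamond a$; $\mathcal O(M)$ and $\mathcal C(M)$ are the sets of open and closed elements. An MT-morphism $h:N\to M$ is a complete Boolean homomorphism with $h(\square a)\le\square h(a)$ for all $a$; isomorphisms are the invertible MT-morphisms (Boolean isomorphisms commuting with $\square$). For a topological space $X$, $\mathscr P(X)$ is the MT-algebra given by the powerset of $X$ with the topological interior operator. For an MT-algebra $M$, $\mathrm{at}(M)$ is the set of atoms of $M$ with the topology whose open sets are $\{x\in\mathrm{at}(M)\mid x\le u\}$ for $u\in\mathcal O(M)$. Classical Wallman extension. For a $T_1$-space $X$, $\mathsf{w}X$ is the set of maximal proper filters of the lattice of closed subsets of $X$, with the topology having the sets $\{F\in\mathsf{w}X\mid C\in F\}$, $C$ closed in $X$, as a closed base. Wallman extension of an MT-algebra. For an MT-algebra $M$ put $\mathcal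 B=\mathcal C(M)$ and $\mathsf{w}M=\mathbf{RO}(X_{\mathcal B})$. Here $X_{\mathcal B}$ is the set of proper filters of $\mathcal B$ ordered by inclusion and given the topology of upsets; $\mathbf{RO}(X_{\mathcal B})$ is the complete Boolean algebra of its regular open sets, i.e. upsets $U$ with $U=\{x\mid \mathord{\uparrow}x\subseteq\mathord{\downarrow}U\}$. For $a\in M$, $$\sigma_{\mathcal B}(a)=\{x\in X_{\mathcal B}\mid \text{for all } y\in X_{\mathcal B}\text{ with }x\subseteq y\text{ and all }b\in y,\ a\wedge b\ne0\}\in\mathbf{RO}(X_{\mathcal B}).$$ $\mathbf{RO}(X_{\mathcal B})$ is made an MT-algebra by declaring its closed elements to be the arbitrary meets of elements of $\{\sigma_{\mathcal B}(b)\mid b\in\mathcal B\}$ (the open elements are the complements of closed ones, and $\square A$ is the largest open element below $A$). *)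

theory Defs
  imports "HOL-Algebra.Complete_Lattice" "HOL-Analysis.Analysis"
begin

no_notation eq_closure_of (\<open>closure'_of\<index>\<close>)

section \<open>MT-algebras\<close>

text \<open>
  Lattices are carrier-based, in the style of \<^theory>\<open>HOL-Algebra.Complete_Lattice\<close>. The type
  classes for complete Boolean algebras in Main are of no use here: they fix a whole type as the
  underlying set, and they require complete distributivity (hence atomicity).
\<close>

locale complete_boolean_lattice = Complete_Lattice.complete_lattice L for L (structure) +
  assumes distributive:
      "\<lbrakk>x \<in> carrier L; y \<in> carrier L; z \<in> carrier L\<rbrakk> \<Longrightarrow> x \<sqinter> (y \<squnion> z) = (x \<sqinter> y) \<squnion> (x \<sqinter> z)"
    and complemented:
      "x \<in> carrier L \<Longrightarrow> \<exists>y\<in>carrier L. x \<sqinter> y = \<bottom> \<and> x \<squnion> y = \<top>"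

definition complement :: "('a, 'b) gorder_scheme \<Rightarrow> 'a \<Rightarrow> 'a" where
  "complement L a = (THE b. b \<in> carrier L \<and> a \<sqinter>\<^bsub>L\<^esub> b = \<bottom>\<^bsub>L\<^esub> \<and> a \<squnion>\<^bsub>L\<^esub> b = \<top>\<^bsub>L\<^esub>)"

record 'a mt = "'a gorder" +
  mt_box :: "'a \<Rightarrow> 'a" (\<open>\<box>\<index> _\<close> [81] 80)

locale mt_algebra = complete_boolean_lattice M for M (structure) +
  assumes box_closed: "a \<in> carrier M \<Longrightarrow> \<box> a \<in> carrier M"
    and box_top: "\<box> \<top> = \<top>"
    and box_meet: "\<lbrakk>a \<in> carrier M; b \<in> carrier M\<rbrakk> \<Longrightarrow> \<box> (a \<sqinter> b) = \<box> a \<sqinter> \<box> b"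
    and box_le: "a \<in> carrier M \<Longrightarrow> \<box> a \<sqsubseteq> a"
    and box_le_box_box: "a \<in> carrier M \<Longrightarrow> \<box> a \<sqsubseteq> \<box> (\<box> a)"

definition mt_diamond :: "('a, 'b) mt_scheme \<Rightarrow> 'a \<Rightarrow> 'a" (\<open>\<diamond>\<index> _\<close> [81] 80) where
  "\<diamond>\<^bsub>M\<^esub> a = complement M (\<box>\<^bsub>M\<^esub> (complement M a))"

definition open_elems :: "('a, 'b) mt_scheme \<Rightarrow> 'a set" where
  "open_elems M = {a \<in> carrier M. a = \<box>\<^bsub>M\<^esub> a}"

definition closed_elems :: "('a, 'b) mt_scheme \<Rightarrow> 'a set" where
  "closed_elems M = {a \<in> carrier M. a = \<diamond>\<^bsub>M\<^esub> a}"

definition mt_morphism :: "('a, 'c) mt_scheme \<Rightarrow> ('b, 'd) mt_scheme \<Rightarrow> ('a \<Rightarrow> 'b) \<Rightarrow> bool" where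
  "mt_morphism N M h \<longleftrightarrow>
     mt_algebra N \<and> mt_algebra M \<and>
     h \<in> carrier N \<rightarrow> carrier M \<and>
     sup_pres N M h \<and> inf_pres N M h \<and>
     (\<forall>a\<in>carrier N. h (complement N a) = complement M (h a)) \<and>
     (\<forall>a\<in>carrier N. h (\<box>\<^bsub>N\<^esub> a) \<sqsubseteq>\<^bsub>M\<^esub> \<box>\<^bsub>M\<^esub> (h a))"

definition mt_isomorphic :: "('a, 'c) mt_scheme \<Rightarrow> ('b, 'd) mt_scheme \<Rightarrow> bool"
    (infix \<open>\<cong>\<^sub>M\<^sub>T\<close> 50) where
  "N \<cong>\<^sub>M\<^sub>T M \<longleftrightarrow>
     (\<exists>h g. mt_morphism N M h \<and> mt_morphism M N g \<and>
            (\<forall>a\<in>carrier N. g (h a) = a) \<and> (\<forall>b\<in>carrier M. h (g b) = b))"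

definition powerset_mt :: "'a topology \<Rightarrow> 'a set mt" where
  "powerset_mt X =
     \<lparr>carrier = Pow (topspace X), eq = (=), le = (\<subseteq>), mt_box = (\<lambda>A. X interior_of A)\<rparr>"

definition atoms :: "('a, 'b) gorder_scheme \<Rightarrow> 'a set" where
  "atoms L = {x \<in> carrier L. x \<noteq> \<bottom>\<^bsub>L\<^esub> \<and> (\<forall>y\<in>carrier L. y \<sqsubseteq>\<^bsub>L\<^esub> x \<longrightarrow> y = \<bottom>\<^bsub>L\<^esub> \<or> y = x)}"

definition atom_space :: "('a, 'b) mt_scheme \<Rightarrow> 'a topology" where
  "atom_space M = topology (\<lambda>U. \<exists>u\<in>open_elems M. U = {x \<in> atoms M. x \<sqsubseteq>\<^bsub>M\<^esub> u})"


text \<open>The stated sets of atoms do form a topology.\<close>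

lemma (in mt_algebra) openin_atom_space:
  "openin (atom_space M) U \<longleftrightarrow> (\<exists>u\<in>open_elems M. U = {x \<in> atoms M. x \<sqsubseteq> u})"
proof -
  have mono: "\<box> a \<sqsubseteq> \<box> b" if "a \<in> carrier M" "b \<in> carrier M" "a \<sqsubseteq> b" for a b
  proof -
    have "a \<sqinter> b = a"
      using that by (meson le_antisym meet_closed meet_left meet_le le_refl)
    then have "\<box> a = \<box> a \<sqinter> \<box> b" using box_meet that by metis
    then show ?thesis using meet_right[OF box_closed box_closed, of a b] that by simp
  qed
  have atom_sup: "x \<sqsubseteq> \<Squnion>S \<longleftrightarrow> (\<exists>s\<in>S. x \<sqsubseteq> s)" if x: "x \<in> atoms M" and S: "S \<subseteq> carrier M" for x S
  proof
    have xM: "x \<in> carrier M" using x by (simp add: atoms_def)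
    assume le: "x \<sqsubseteq> \<Squnion>S"
    show "\<exists>s\<in>S. x \<sqsubseteq> s"
    proof (rule ccontr)
      assume no: "\<not> (\<exists>s\<in>S. x \<sqsubseteq> s)"
      obtain y where y: "y \<in> carrier M" "x \<sqinter> y = \<bottom>" "x \<squnion> y = \<top>"
        using complemented xM by blast
      have "s \<sqsubseteq> y" if s: "s \<in> S" for s
      proof -
        have sM: "s \<in> carrier M" using s S by blast
        have "s \<sqinter> x \<sqsubseteq> x" "s \<sqinter> x \<in> carrier M" "s \<sqinter> x \<sqsubseteq> s"
          using meet_right meet_left xM sM by auto
        then have "s \<sqinter> x = \<bottom> \<or> s \<sqinter> x = x" using x by (auto simp: atoms_def)
        then have b: "s \<sqinter> x = \<bottom>" using no s \<open>s \<sqinter> x \<sqsubseteq> s\<close> by auto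
        have "s = s \<sqinter> (x \<squnion> y)" using y sM
          by (metis le_antisym le_refl meet_closed meet_le meet_left top_closed top_higher)
        also have "\<dots> = (s \<sqinter> x) \<squnion> (s \<sqinter> y)" using distributive sM xM y by blast
        also have "\<dots> = s \<sqinter> y"
          unfolding b using sM y
          by (meson bottom_closed bottom_lower join_closed join_le join_right le_antisym le_refl meet_closed)
        finally show ?thesis using meet_right sM y by metis
      qed
      then have "\<Squnion>S \<sqsubseteq> y" using sup_least[OF S] y by blast
      then have "x \<sqsubseteq> y" using le_trans[OF le _ xM sup_closed[OF S] y(1)] by simp
      then have "x \<sqsubseteq> x \<sqinter> y" using meet_le[OF le_refl[OF xM] _ xM y(1) xM] by simp
      then have "x = \<bottom>" using y xM by (metis bottom_closed bottom_lower le_antisym)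
      then show False using x by (simp add: atoms_def)
    qed
  next
    have xM: "x \<in> carrier M" using x by (simp add: atoms_def)
    assume "\<exists>s\<in>S. x \<sqsubseteq> s"
    then obtain s where s: "s \<in> S" "x \<sqsubseteq> s" "s \<in> carrier M" using S by blast
    then show "x \<sqsubseteq> \<Squnion>S"
      using le_trans[OF s(2) sup_upper[OF S s(1)] xM s(3) sup_closed[OF S]] by simp
  qed
  have "istopology (\<lambda>U. \<exists>u\<in>open_elems M. U = {x \<in> atoms M. x \<sqsubseteq> u})"
    unfolding istopology_def
  proof (intro conjI allI impI)
    fix U V
    assume "\<exists>u\<in>open_elems M. U = {x \<in> atoms M. x \<sqsubseteq> u}"
      "\<exists>u\<in>open_elems M. V = {x \<in> atoms M. x \<sqsubseteq> u}"
    then obtain u v where u: "u \<in> carrier M" "\<box> u = u" "U = {x \<in> atoms M. x \<sqsubseteq> u}"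
      and v: "v \<in> carrier M" "\<box> v = v" "V = {x \<in> atoms M. x \<sqsubseteq> v}"
      by (auto simp: open_elems_def)
    have "x \<sqsubseteq> u \<sqinter> v \<longleftrightarrow> x \<sqsubseteq> u \<and> x \<sqsubseteq> v" if "x \<in> atoms M" for x
    proof -
      have xM: "x \<in> carrier M" using that by (simp add: atoms_def)
      have m: "u \<sqinter> v \<in> carrier M" "u \<sqinter> v \<sqsubseteq> u" "u \<sqinter> v \<sqsubseteq> v"
        using u(1) v(1) by (simp_all add: meet_left meet_right)
      show ?thesis
        using le_trans[OF _ m(2) xM m(1) u(1)] le_trans[OF _ m(3) xM m(1) v(1)]
          meet_le[OF _ _ u(1) v(1) xM] by blast
    qed
    then have "U \<inter> V = {x \<in> atoms M. x \<sqsubseteq> u \<sqinter> v}" using u v by auto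
    moreover have "u \<sqinter> v \<in> open_elems M"
      using u v box_meet by (simp add: open_elems_def)
    ultimately show "\<exists>w\<in>open_elems M. U \<inter> V = {x \<in> atoms M. x \<sqsubseteq> w}" by blast
  next
    fix \<K>
    assume K: "\<forall>U\<in>\<K>. \<exists>u\<in>open_elems M. U = {x \<in> atoms M. x \<sqsubseteq> u}"
    define S where "S = {u \<in> open_elems M. {x \<in> atoms M. x \<sqsubseteq> u} \<in> \<K>}"
    have S: "S \<subseteq> carrier M" by (auto simp: S_def open_elems_def)
    have "s \<sqsubseteq> \<box> (\<Squnion>S)" if "s \<in> S" for s
    proof -
      have "s = \<box> s" "s \<in> carrier M" using that by (auto simp: S_def open_elems_def)
      then show ?thesis using mono[of s "\<Squnion>S"] sup_upper[OF S that] S by auto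
    qed
    then have "\<Squnion>S \<sqsubseteq> \<box> (\<Squnion>S)" 
      using sup_least[OF S] box_closed[OF sup_closed[OF S]] by simp
    then have o: "\<Squnion>S \<in> open_elems M"
      using le_antisym[OF _ box_le] box_closed sup_closed[OF S] by (simp add: open_elems_def)
    have "\<Union>\<K> = {x \<in> atoms M. x \<sqsubseteq> \<Squnion>S}"
    proof (intro Set.set_eqI iffI)
      fix x assume "x \<in> \<Union>\<K>"
      then obtain U where U: "U \<in> \<K>" "x \<in> U" by (rule UnionE)
      then obtain u where u: "u \<in> open_elems M" "U = {x \<in> atoms M. x \<sqsubseteq> u}" using K by meson
      then have "u \<in> S" using U by (simp add: S_def)
      moreover have "x \<in> atoms M" "x \<sqsubseteq> u" using U u by simp_all
      ultimately have "x \<sqsubseteq> \<Squnion>S" using atom_sup[OF _ S] by metis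
      with \<open>x \<in> atoms M\<close> show "x \<in> {x \<in> atoms M. x \<sqsubseteq> \<Squnion>S}" by simp
    next
      fix x assume "x \<in> {x \<in> atoms M. x \<sqsubseteq> \<Squnion>S}"
      then have x: "x \<in> atoms M" "x \<sqsubseteq> \<Squnion>S" by simp_all
      then obtain s where s: "s \<in> S" "x \<sqsubseteq> s" using atom_sup[OF _ S] by metis
      then have "{x \<in> atoms M. x \<sqsubseteq> s} \<in> \<K>" by (simp add: S_def)
      then show "x \<in> \<Union>\<K>" by (rule UnionI) (use x s in simp)
    qed
    then show "\<exists>u\<in>open_elems M. \<Union>\<K> = {x \<in> atoms M. x \<sqsubseteq> u}" using o by blast
  qed
  then show ?thesis by (simp add: atom_space_def topology_inverse')
qed


section \<open>Filters and the classical Wallman extension\<close>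

definition proper_filters :: "('a, 'b) gorder_scheme \<Rightarrow> 'a set set" where
  "proper_filters L =
     {F. F \<subseteq> carrier L \<and> F \<noteq> {} \<and>
         (\<forall>a\<in>F. \<forall>b\<in>carrier L. a \<sqsubseteq>\<^bsub>L\<^esub> b \<longrightarrow> b \<in> F) \<and>
         (\<forall>a\<in>F. \<forall>b\<in>F. a \<sqinter>\<^bsub>L\<^esub> b \<in> F) \<and>
         F \<noteq> carrier L}"

definition maximal_filters :: "('a, 'b) gorder_scheme \<Rightarrow> 'a set set" where
  "maximal_filters L = {F \<in> proper_filters L. \<forall>G\<in>proper_filters L. F \<subseteq> G \<longrightarrow> G = F}"

definition closed_set_lattice :: "'a topology \<Rightarrow> 'a set gorder" where
  "closed_set_lattice X = \<lparr>carrier = {C. closedin X C}, eq = (=), le = (\<subseteq>)\<rparr>"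

definition wallman_points :: "'a topology \<Rightarrow> 'a set set set" where
  "wallman_points X = maximal_filters (closed_set_lattice X)"

text \<open>The sets \<open>{F. C \<in> F}\<close> form a closed base, so their complements form an open base.\<close>

definition wallman_space :: "'a topology \<Rightarrow> 'a set set topology" where
  "wallman_space X =
     topology (arbitrary union_of
       (\<lambda>U. \<exists>C. closedin X C \<and> U = wallman_points X - {F \<in> wallman_points X. C \<in> F}))"


lemma meet_closed_set_lattice:
  assumes "closedin X A" "closedin X B"
  shows "A \<sqinter>\<^bsub>closed_set_lattice X\<^esub> B = A \<inter> B"
proof -
  have L: "Lower (closed_set_lattice X) {A, B} = {C. closedin X C \<and> C \<subseteq> A \<inter> B}"
    using assms by (auto simp: closed_set_lattice_def Lower_def)
  have AB: "closedin X (A \<inter> B)" using assms by (rule closedin_Int)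
  have "greatest (closed_set_lattice X) G (Lower (closed_set_lattice X) {A, B}) \<longleftrightarrow> G = A \<inter> B" for G
  proof
    assume "greatest (closed_set_lattice X) G (Lower (closed_set_lattice X) {A, B})"
    then have "G \<subseteq> A \<inter> B" "A \<inter> B \<subseteq> G"
      unfolding L greatest_def using AB by (simp_all add: closed_set_lattice_def)
    then show "G = A \<inter> B" by (rule subset_antisym)
  next
    assume "G = A \<inter> B"
    then show "greatest (closed_set_lattice X) G (Lower (closed_set_lattice X) {A, B})"
      unfolding L greatest_def using AB by (auto simp: closed_set_lattice_def)
  qed
  then show ?thesis by (simp add: meet_def Lattice.inf_def)
qed

lemma proper_filters_closed_set_lattice:
  "F \<in> proper_filters (closed_set_lattice X) \<longleftrightarrow>
     F \<subseteq> {C. closedin X C} \<and> F \<noteq> {} \<and> {} \<notin> F \<and>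
     (\<forall>A\<in>F. \<forall>B. closedin X B \<and> A \<subseteq> B \<longrightarrow> B \<in> F) \<and> (\<forall>A\<in>F. \<forall>B\<in>F. A \<inter> B \<in> F)"
  (is "?l \<longleftrightarrow> ?r")
proof -
  have carr: "carrier (closed_set_lattice X) = {C. closedin X C}"
    and le: "le (closed_set_lattice X) = (\<subseteq>)"
    by (simp_all add: closed_set_lattice_def)
  have inter: "(\<forall>A\<in>F. \<forall>B\<in>F. A \<sqinter>\<^bsub>closed_set_lattice X\<^esub> B \<in> F) \<longleftrightarrow> (\<forall>A\<in>F. \<forall>B\<in>F. A \<inter> B \<in> F)"
    if "F \<subseteq> {C. closedin X C}"
  proof (intro ball_cong refl)
    fix A B assume "A \<in> F" "B \<in> F"
    then have "closedin X A" "closedin X B" using that by auto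
    then show "A \<sqinter>\<^bsub>closed_set_lattice X\<^esub> B \<in> F \<longleftrightarrow> A \<inter> B \<in> F"
      by (simp add: meet_closed_set_lattice)
  qed
  have empty: "F \<noteq> {C. closedin X C} \<longleftrightarrow> {} \<notin> F"
    if "F \<subseteq> {C. closedin X C}" "\<forall>A\<in>F. \<forall>B. closedin X B \<and> A \<subseteq> B \<longrightarrow> B \<in> F"
  proof
    assume ne: "F \<noteq> {C. closedin X C}"
    show "{} \<notin> F"
    proof
      assume "{} \<in> F"
      then have "B \<in> F" if "closedin X B" for B
        using \<open>\<forall>A\<in>F. \<forall>B. closedin X B \<and> A \<subseteq> B \<longrightarrow> B \<in> F\<close> that by fast
      then show False using ne that(1) by auto
    qed
  next
    assume "{} \<notin> F"
    then show "F \<noteq> {C. closedin X C}" by (metis closedin_empty mem_Collect_eq)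
  qed
  have up: "(\<forall>A\<in>F. \<forall>B\<in>{C. closedin X C}. A \<subseteq> B \<longrightarrow> B \<in> F) \<longleftrightarrow>
      (\<forall>A\<in>F. \<forall>B. closedin X B \<and> A \<subseteq> B \<longrightarrow> B \<in> F)"
    by auto
  have logic: "(s \<Longrightarrow> m = i) \<Longrightarrow> (s \<Longrightarrow> u \<Longrightarrow> c = e) \<Longrightarrow>
      (s \<and> n \<and> u \<and> m \<and> c) = (s \<and> n \<and> e \<and> u \<and> i)" for s m i u c e n :: bool
    by blast
  show ?thesis
    unfolding proper_filters_def carr le mem_Collect_eq[of F] up
    by (rule logic[OF inter empty])
qed

lemma wallman_points_prime:
  assumes F: "F \<in> wallman_points X" and C: "closedin X C" and D: "closedin X D"
    and CD: "C \<union> D \<in> F"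
  shows "C \<in> F \<or> D \<in> F"
proof -
  have Fp: "F \<in> proper_filters (closed_set_lattice X)"
    and max: "\<And>G. \<lbrakk>G \<in> proper_filters (closed_set_lattice X); F \<subseteq> G\<rbrakk> \<Longrightarrow> G = F"
    using F by (auto simp: wallman_points_def maximal_filters_def)
  note Fp' = Fp[unfolded proper_filters_closed_set_lattice]
  have disj: "\<exists>A\<in>F. A \<inter> E = {}" if E: "closedin X E" "E \<notin> F" for E
  proof (rule ccontr)
    assume no: "\<not> (\<exists>A\<in>F. A \<inter> E = {})"
    define G where "G = {B. closedin X B \<and> (\<exists>A\<in>F. A \<inter> E \<subseteq> B)}"
    have "G \<in> proper_filters (closed_set_lattice X)"
      unfolding proper_filters_closed_set_lattice
    proof (intro conjI ballI)
      show "G \<noteq> {}" using Fp' by (auto simp: G_def)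
      show "{} \<notin> G" using no by (auto simp: G_def)
      fix A B assume "A \<in> G" "B \<in> G"
      then obtain A' B' where "A' \<in> F" "A' \<inter> E \<subseteq> A" "B' \<in> F" "B' \<inter> E \<subseteq> B" "closedin X A" "closedin X B"
        by (auto simp: G_def)
      moreover have "A' \<inter> B' \<in> F" using Fp' calculation by blast
      moreover have "(A' \<inter> B') \<inter> E \<subseteq> A \<inter> B" using calculation by blast
      ultimately show "A \<inter> B \<in> G" unfolding G_def by blast
    qed (auto simp: G_def)
    moreover have "F \<subseteq> G" using Fp' by (auto simp: G_def)
    ultimately have "G = F" by (rule max)
    moreover have "E \<in> G" using Fp' E by (auto simp: G_def)
    ultimately show False using E by blast
  qed
  show ?thesis
  proof (rule ccontr)
    assume "\<not> ?thesis"
    then obtain A B where "A \<in> F" "A \<inter> C = {}" "B \<in> F" "B \<inter> D = {}" using disj C D by meson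
    moreover have Int: "A \<inter> B \<in> F" if "A \<in> F" "B \<in> F" for A B using Fp' that by blast
    ultimately have "(A \<inter> B) \<inter> (C \<union> D) \<in> F" using CD by simp
    moreover have "(A \<inter> B) \<inter> (C \<union> D) = {}"
      using \<open>A \<inter> C = {}\<close> \<open>B \<inter> D = {}\<close> by auto
    ultimately show False using Fp' by simp
  qed
qed

text \<open>That the prescribed sets are a base of some topology uses primeness of maximal filters.\<close>

lemma openin_wallman_space:
  "openin (wallman_space X) =
     arbitrary union_of
       (\<lambda>U. \<exists>C. closedin X C \<and> U = wallman_points X - {F \<in> wallman_points X. C \<in> F})"
proof -
  let ?W = "wallman_points X"
  let ?B = "\<lambda>C. ?W - {F \<in> ?W. C \<in> F}"
  have Un: "C \<union> D \<in> F \<longleftrightarrow> C \<in> F \<or> D \<in> F"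
    if F: "F \<in> ?W" and CD: "closedin X C" "closedin X D" for C D F
  proof
    assume "C \<in> F \<or> D \<in> F"
    have "F \<in> proper_filters (closed_set_lattice X)"
      using F by (simp add: wallman_points_def maximal_filters_def)
    then have up: "\<forall>A\<in>F. \<forall>B. closedin X B \<and> A \<subseteq> B \<longrightarrow> B \<in> F"
      by (simp add: proper_filters_closed_set_lattice)
    have "closedin X (C \<union> D)" using CD by (rule closedin_Un)
    with up \<open>C \<in> F \<or> D \<in> F\<close> show "C \<union> D \<in> F" by (metis Un_upper1 Un_upper2)
  qed (rule wallman_points_prime[OF F CD])
  have Int: "?B C \<inter> ?B D = ?B (C \<union> D)" if "closedin X C" "closedin X D" for C D
    using Un[OF _ that] by auto
  have "istopology (arbitrary union_of (\<lambda>U. \<exists>C. closedin X C \<and> U = ?B C))"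
  proof (rule istopology_base, elim exE conjE)
    fix S T C D
    assume "closedin X C" "S = ?B C" "closedin X D" "T = ?B D"
    then show "\<exists>E. closedin X E \<and> S \<inter> T = ?B E"
      by (intro exI[of _ "C \<union> D"]) (simp only: Int closedin_Un simp_thms)
  qed
  then show ?thesis by (simp add: wallman_space_def topology_inverse')
qed

lemma topspace_wallman_space: "topspace (wallman_space X) = wallman_points X"
proof -
  have "{F \<in> wallman_points X. {} \<in> F} = {}"
    by (auto simp: wallman_points_def maximal_filters_def proper_filters_closed_set_lattice)
  then have "openin (wallman_space X) (wallman_points X)"
    unfolding openin_wallman_space by (intro arbitrary_union_of_inc exI[of _ "{}"]) auto
  moreover have "U \<subseteq> wallman_points X" if "openin (wallman_space X) U" for U
    using that unfolding openin_wallman_space union_of_def arbitrary_def by blast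
  ultimately show ?thesis by (simp add: openin_subset subset_antisym topspace_def Sup_le_iff Union_upper)
qed

lemma closedin_wallman_space:
  "closedin (wallman_space X) K \<longleftrightarrow>
     (\<exists>\<C> \<subseteq> {C. closedin X C}. K = {F \<in> wallman_points X. \<C> \<subseteq> F})"
proof
  let ?W = "wallman_points X"
  assume "closedin (wallman_space X) K"
  then have K: "K \<subseteq> ?W" and "openin (wallman_space X) (?W - K)"
    by (auto simp: closedin_def topspace_wallman_space)
  then obtain \<U> where sub: "\<U> \<subseteq> {U. \<exists>C. closedin X C \<and> U = ?W - {F \<in> ?W. C \<in> F}}"
    and U: "\<Union>\<U> = ?W - K"
    unfolding openin_wallman_space union_of_def by (elim exE conjE) (rule that)
  have base: "\<exists>C. closedin X C \<and> V = ?W - {F \<in> ?W. C \<in> F}" if "V \<in> \<U>" for V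
    using subsetD[OF sub that] by (rule CollectD)
  define \<C> where "\<C> = {C. closedin X C \<and> ?W - {F \<in> ?W. C \<in> F} \<in> \<U>}"
  have "K = {F \<in> ?W. \<C> \<subseteq> F}"
  proof (intro Set.set_eqI iffI)
    fix F assume F: "F \<in> K"
    have "C \<in> F" if "C \<in> \<C>" for C
    proof (rule ccontr)
      assume "C \<notin> F"
      then have "F \<in> ?W - {F \<in> ?W. C \<in> F}" using F K by auto
      moreover have "?W - {F \<in> ?W. C \<in> F} \<in> \<U>" using that by (simp add: \<C>_def)
      ultimately have "F \<in> \<Union>\<U>" by (rule UnionI[rotated])
      then show False using U F by simp
    qed
    then show "F \<in> {F \<in> ?W. \<C> \<subseteq> F}" using F K by auto
  next
    fix F assume F: "F \<in> {F \<in> ?W. \<C> \<subseteq> F}"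
    show "F \<in> K"
    proof (rule ccontr)
      assume "F \<notin> K"
      then have "F \<in> \<Union>\<U>" using F U by simp
      then obtain U where V: "U \<in> \<U>" "F \<in> U" by (rule UnionE)
      then obtain C where C: "closedin X C" "U = ?W - {F \<in> ?W. C \<in> F}" using base by meson
      then have "C \<in> \<C>" using V by (simp add: \<C>_def)
      then show False using F C V by auto
    qed
  qed
  then show "\<exists>\<C> \<subseteq> {C. closedin X C}. K = {F \<in> ?W. \<C> \<subseteq> F}"
    by (intro exI[of _ \<C>] conjI) (auto simp: \<C>_def)
next
  let ?W = "wallman_points X"
  assume "\<exists>\<C> \<subseteq> {C. closedin X C}. K = {F \<in> ?W. \<C> \<subseteq> F}"
  then obtain \<C> where C: "\<C> \<subseteq> {C. closedin X C}" "K = {F \<in> ?W. \<C> \<subseteq> F}" by blast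
  have "openin (wallman_space X) (\<Union>C\<in>\<C>. ?W - {F \<in> ?W. C \<in> F})"
    unfolding openin_wallman_space
    by (intro arbitrary_union_of_Union, elim imageE, hypsubst, intro arbitrary_union_of_inc)
      (use C(1) in auto)
  moreover have "(\<Union>C\<in>\<C>. ?W - {F \<in> ?W. C \<in> F}) = ?W - K" using C(2) by auto
  ultimately show "closedin (wallman_space X) K"
    using C by (auto simp: closedin_def topspace_wallman_space)
qed


section \<open>The Wallman extension of an MT-algebra\<close>

definition closed_elems_lattice :: "('a, 'b) mt_scheme \<Rightarrow> 'a gorder" where
  "closed_elems_lattice M = \<lparr>carrier = closed_elems M, eq = (=), le = (\<sqsubseteq>\<^bsub>M\<^esub>)\<rparr>"

abbreviation closed_filters :: "('a, 'b) mt_scheme \<Rightarrow> 'a set set" where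
  "closed_filters M \<equiv> proper_filters (closed_elems_lattice M)"

definition upset_topology :: "'a set set \<Rightarrow> 'a set topology" where
  "upset_topology P = topology (\<lambda>U. U \<subseteq> P \<and> (\<forall>x\<in>U. \<forall>y\<in>P. x \<subseteq> y \<longrightarrow> y \<in> U))"

lemma openin_upset_topology:
  "openin (upset_topology P) U \<longleftrightarrow> U \<subseteq> P \<and> (\<forall>x\<in>U. \<forall>y\<in>P. x \<subseteq> y \<longrightarrow> y \<in> U)"
proof -
  have "istopology (\<lambda>U. U \<subseteq> P \<and> (\<forall>x\<in>U. \<forall>y\<in>P. x \<subseteq> y \<longrightarrow> y \<in> U))"
    unfolding istopology_def by blast
  then show ?thesis by (simp add: upset_topology_def topology_inverse')
qed

lemma topspace_upset_topology: "topspace (upset_topology P) = P"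
  unfolding topspace_def openin_upset_topology by auto

definition regular_opens :: "'a topology \<Rightarrow> 'a set gorder" where
  "regular_opens T =
     \<lparr>carrier = {U. U = T interior_of (T closure_of U)}, eq = (=), le = (\<subseteq>)\<rparr>"

text \<open>The order-theoretic description: \<open>U\<close> is an upset with \<open>U = {x. \<up>x \<subseteq> \<down>U}\<close>.\<close>

lemma carrier_regular_opens_upset_topology:
  "U \<in> carrier (regular_opens (upset_topology P)) \<longleftrightarrow>
     openin (upset_topology P) U \<and> U = {x \<in> P. \<forall>y\<in>P. x \<subseteq> y \<longrightarrow> (\<exists>z\<in>U. y \<subseteq> z)}"
proof -
  let ?T = "upset_topology P"
  have cl: "?T closure_of U = {y \<in> P. \<exists>z\<in>U \<inter> P. y \<subseteq> z}" for U
  proof (intro Set.set_eqI iffI)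
    fix y assume y: "y \<in> ?T closure_of U"
    have "openin ?T {z \<in> P. y \<subseteq> z}" by (auto simp: openin_upset_topology)
    moreover have "y \<in> P" "\<forall>V. y \<in> V \<and> openin ?T V \<longrightarrow> (\<exists>z. z \<in> U \<and> z \<in> V)"
      using y by (auto simp: in_closure_of topspace_upset_topology)
    ultimately obtain z where "z \<in> U" "z \<in> {z \<in> P. y \<subseteq> z}" by (metis (mono_tags) mem_Collect_eq order_refl)
    with \<open>y \<in> P\<close> show "y \<in> {y \<in> P. \<exists>z\<in>U \<inter> P. y \<subseteq> z}" by auto
  next
    fix y assume "y \<in> {y \<in> P. \<exists>z\<in>U \<inter> P. y \<subseteq> z}"
    then obtain z where "y \<in> P" "z \<in> U" "z \<in> P" "y \<subseteq> z" by auto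
    moreover have "z \<in> V" if "y \<in> V" "openin ?T V" for V
      using that \<open>z \<in> P\<close> \<open>y \<subseteq> z\<close> by (simp add: openin_upset_topology)
    ultimately show "y \<in> ?T closure_of U"
      unfolding in_closure_of topspace_upset_topology by auto
  qed
  have int: "?T interior_of V = {x \<in> P. \<forall>y\<in>P. x \<subseteq> y \<longrightarrow> y \<in> V}" for V
  proof (intro Set.set_eqI iffI)
    fix x assume "x \<in> ?T interior_of V"
    then obtain W where W: "openin ?T W" "x \<in> W" "W \<subseteq> V" by (auto simp: interior_of_def)
    then have "x \<in> P" "\<forall>y\<in>P. x \<subseteq> y \<longrightarrow> y \<in> W" by (auto simp: openin_upset_topology)
    then show "x \<in> {x \<in> P. \<forall>y\<in>P. x \<subseteq> y \<longrightarrow> y \<in> V}" using W by auto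
  next
    fix x assume x: "x \<in> {x \<in> P. \<forall>y\<in>P. x \<subseteq> y \<longrightarrow> y \<in> V}"
    have "openin ?T {y \<in> P. x \<subseteq> y}" by (auto simp: openin_upset_topology)
    moreover have "x \<in> {y \<in> P. x \<subseteq> y}" "{y \<in> P. x \<subseteq> y} \<subseteq> V" using x by auto
    ultimately show "x \<in> ?T interior_of V" unfolding interior_of_def by auto
  qed
  have "U \<in> carrier (regular_opens ?T) \<longleftrightarrow> U = ?T interior_of (?T closure_of U)"
    by (simp add: regular_opens_def)
  also have "\<dots> \<longleftrightarrow> openin ?T U \<and> U = ?T interior_of (?T closure_of U)"
    by (metis openin_interior_of)
  also have "\<dots> \<longleftrightarrow> openin ?T U \<and> U = {x \<in> P. \<forall>y\<in>P. x \<subseteq> y \<longrightarrow> (\<exists>z\<in>U. y \<subseteq> z)}"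
  proof (rule conj_cong[OF refl])
    assume "openin ?T U"
    then have "U \<inter> P = U" by (auto simp: openin_upset_topology)
    then have "?T interior_of (?T closure_of U) = {x \<in> P. \<forall>y\<in>P. x \<subseteq> y \<longrightarrow> (\<exists>z\<in>U. y \<subseteq> z)}"
      unfolding cl int by auto
    then show "(U = ?T interior_of (?T closure_of U)) \<longleftrightarrow>
      (U = {x \<in> P. \<forall>y\<in>P. x \<subseteq> y \<longrightarrow> (\<exists>z\<in>U. y \<subseteq> z)})" by simp
  qed
  finally show ?thesis .
qed

abbreviation wallman_boolean :: "('a, 'b) mt_scheme \<Rightarrow> 'a set set gorder" where
  "wallman_boolean M \<equiv> regular_opens (upset_topology (closed_filters M))"

definition wallman_sigma :: "('a, 'b) mt_scheme \<Rightarrow> 'a \<Rightarrow> 'a set set" where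
  "wallman_sigma M a =
     {x \<in> closed_filters M. \<forall>y\<in>closed_filters M. x \<subseteq> y \<longrightarrow> (\<forall>b\<in>y. a \<sqinter>\<^bsub>M\<^esub> b \<noteq> \<bottom>\<^bsub>M\<^esub>)}"

definition wallman_closed :: "('a, 'b) mt_scheme \<Rightarrow> 'a set set set" where
  "wallman_closed M = {\<Sqinter>\<^bsub>wallman_boolean M\<^esub> S | S. S \<subseteq> wallman_sigma M ` closed_elems M}"

definition wallman_open :: "('a, 'b) mt_scheme \<Rightarrow> 'a set set set" where
  "wallman_open M = complement (wallman_boolean M) ` wallman_closed M"

definition wallman_mt :: "('a, 'b) mt_scheme \<Rightarrow> 'a set set mt" where
  "wallman_mt M =
     \<lparr>carrier = carrier (wallman_boolean M), eq = (=), le = (\<subseteq>),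
      mt_box = (\<lambda>A. THE U. greatest (wallman_boolean M) U {V \<in> wallman_open M. V \<subseteq> A})\<rparr>"

end

theory Submission
  imports Defs
begin

text \<open>
  By Zorn's lemma every proper filter of closed sets lies below a maximal one, so a regular open
  set of filters is determined by the maximal filters it contains. Sending a set \<open>S\<close> of maximal
  filters to the filters all of whose maximal extensions belong to \<open>S\<close> is therefore an order
  isomorphism from the powerset of the Wallman extension onto the regular open sets. It sends the
  basic closed set \<open>{F. C \<in> F}\<close> to \<open>\<sigma>(C)\<close>, because a maximal filter contains \<open>C\<close> as soon as
  \<open>C\<close> meets all of its members; hence it matches closed elements with closed elements and
  commutes with the interior. The homeomorphism follows, as a space is the space of atoms of its
  powerset.
\<close>

section \<open>Transport along order isomorphisms\<close>

text \<open>Distributivity makes complements unique, so the definite description in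
  \<open>complement\<close> can be evaluated at any witness.\<close>

lemma (in complete_boolean_lattice) complement_eqI:
  assumes "a \<in> carrier L" "b \<in> carrier L" "a \<sqinter> b = \<bottom>" "a \<squnion> b = \<top>"
  shows "complement L a = b"
  unfolding complement_def
proof (rule the_equality)
  \<comment> \<open>Only disjointness of \<open>c\<close> and only the covering property of
    \<open>d\<close> enter here; exchanging the roles of two complements then gives equality by
    antisymmetry.\<close>
  have le: "c \<sqsubseteq> d" if "c \<in> carrier L" "d \<in> carrier L" "a \<sqinter> c = \<bottom>" "a \<squnion> d = \<top>" for c d
  proof -
    have "c \<sqsubseteq> c \<sqinter> (a \<squnion> d)"
      using that assms(1) by (simp add: meet_le)
    also have "c \<sqinter> (a \<squnion> d) = (c \<sqinter> a) \<squnion> (c \<sqinter> d)"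
      using that assms(1) by (intro distributive)
    also have "c \<sqinter> a = \<bottom>"
      using that(3) by (simp add: meet_comm)
    also have "\<bottom> \<squnion> (c \<sqinter> d) \<sqsubseteq> d"
      using that by (simp add: join_le meet_right)
    finally show ?thesis using that assms(1) by simp
  qed
  show "c = b" if "c \<in> carrier L \<and> a \<sqinter> c = \<bottom> \<and> a \<squnion> c = \<top>" for c
    using that assms by (simp add: le_antisym le)
qed (use assms in simp)

text \<open>All lattice structure is assumed on the source alone. The target is a bare ordered
  carrier with true equality, and its completeness, distributivity and complements are transported
  along \<open>h\<close>. For the regular open sets this replaces a direct computation of joins and
  complements.\<close>

locale complete_boolean_iso = complete_boolean_lattice N for N (structure) +
  fixes M :: "('c, 'd) gorder_scheme" and h
  assumes eq_target: "eq M = (=)"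
    and bij: "bij_betw h (carrier N) (carrier M)"
    and le_iff: "\<lbrakk>a \<in> carrier N; b \<in> carrier N\<rbrakk> \<Longrightarrow> h a \<sqsubseteq>\<^bsub>M\<^esub> h b \<longleftrightarrow> a \<sqsubseteq> b"
begin

lemma carrier_target: "carrier M = h ` carrier N"
  using bij by (simp add: bij_betw_def)

lemma h_closed [simp]: "a \<in> carrier N \<Longrightarrow> h a \<in> carrier M"
  by (simp add: carrier_target)

lemma h_eq_iff [simp]: "\<lbrakk>a \<in> carrier N; b \<in> carrier N\<rbrakk> \<Longrightarrow> h a = h b \<longleftrightarrow> a = b"
  using bij by (auto simp: bij_betw_def inj_on_def)

lemma least_image: "least N x A \<Longrightarrow> least M (h x) (h ` A)"
  unfolding least_def carrier_target using le_iff by blast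

lemma greatest_image: "greatest N x A \<Longrightarrow> greatest M (h x) (h ` A)"
  unfolding greatest_def carrier_target using le_iff by blast

lemma Upper_image:
  assumes "A \<subseteq> carrier N"
  shows "Upper M (h ` A) = h ` Upper N A"
proof -
  have "Upper M (h ` A) = h ` {b \<in> carrier N. \<forall>a\<in>A. h a \<sqsubseteq>\<^bsub>M\<^esub> h b}"
    using assms by (auto simp: Upper_def carrier_target)
  also have "{b \<in> carrier N. \<forall>a\<in>A. h a \<sqsubseteq>\<^bsub>M\<^esub> h b} = Upper N A"
    using assms by (auto simp: Upper_def le_iff subset_iff)
  finally show ?thesis .
qed

lemma Lower_image:
  assumes "A \<subseteq> carrier N"
  shows "Lower M (h ` A) = h ` Lower N A"
proof -
  have "Lower M (h ` A) = h ` {b \<in> carrier N. \<forall>a\<in>A. h b \<sqsubseteq>\<^bsub>M\<^esub> h a}"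
    using assms by (auto simp: Lower_def carrier_target)
  also have "{b \<in> carrier N. \<forall>a\<in>A. h b \<sqsubseteq>\<^bsub>M\<^esub> h a} = Lower N A"
    using assms by (auto simp: Lower_def le_iff subset_iff)
  finally show ?thesis .
qed

lemma partial_order_target: "partial_order M"
proof unfold_locales
  show "x \<sqsubseteq>\<^bsub>M\<^esub> z"
    if "x \<sqsubseteq>\<^bsub>M\<^esub> y" "y \<sqsubseteq>\<^bsub>M\<^esub> z" "x \<in> carrier M" "y \<in> carrier M" "z \<in> carrier M" for x y z
    using that le_iff le_trans unfolding carrier_target by fastforce
qed (use le_iff in \<open>auto simp: eq_target carrier_target\<close>)

text \<open>Together with \<open>glb_image\<close> this supplies the completeness of the target;
  uniqueness of least elements later turns it into the formula \<open>sup_image\<close>.\<close>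

lemma lub_image:
  assumes "A \<subseteq> carrier N"
  shows "least M (h (\<Squnion> A)) (Upper M (h ` A))"
  using assms by (simp add: Upper_image least_image sup_lub)

lemma glb_image:
  assumes "A \<subseteq> carrier N"
  shows "greatest M (h (\<Sqinter> A)) (Lower M (h ` A))"
  using assms by (simp add: Lower_image greatest_image inf_glb)

lemma complete_lattice_target: "Complete_Lattice.complete_lattice M"
proof (rule partial_order.complete_latticeI[OF partial_order_target])
  fix B assume "B \<subseteq> carrier M"
  then obtain A where "A \<subseteq> carrier N" "B = h ` A"
    by (metis carrier_target subset_imageE)
  then show "\<exists>s. least M s (Upper M B)" "\<exists>i. greatest M i (Lower M B)"
    using lub_image glb_image by blast+
qed

sublocale target: Complete_Lattice.complete_lattice M
  by (rule complete_lattice_target)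

lemma sup_image: "A \<subseteq> carrier N \<Longrightarrow> \<Squnion>\<^bsub>M\<^esub> (h ` A) = h (\<Squnion> A)"
  by (rule target.least_unique[OF target.sup_lub lub_image]) (auto simp: carrier_target)

lemma inf_image: "A \<subseteq> carrier N \<Longrightarrow> \<Sqinter>\<^bsub>M\<^esub> (h ` A) = h (\<Sqinter> A)"
  by (rule target.greatest_unique[OF target.inf_glb glb_image]) (auto simp: carrier_target)

lemma join_image: "\<lbrakk>a \<in> carrier N; b \<in> carrier N\<rbrakk> \<Longrightarrow> h a \<squnion>\<^bsub>M\<^esub> h b = h (a \<squnion> b)"
  using sup_image[of "{a, b}"] by (simp add: join_def)

lemma meet_image: "\<lbrakk>a \<in> carrier N; b \<in> carrier N\<rbrakk> \<Longrightarrow> h a \<sqinter>\<^bsub>M\<^esub> h b = h (a \<sqinter> b)"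
  using inf_image[of "{a, b}"] by (simp add: meet_def)

lemma top_image: "\<top>\<^bsub>M\<^esub> = h \<top>"
  using greatest_image[OF top_greatest]
  by (intro target.greatest_unique[OF target.top_greatest]) (simp add: carrier_target)

lemma bottom_image: "\<bottom>\<^bsub>M\<^esub> = h \<bottom>"
  using least_image[OF bottom_least]
  by (intro target.least_unique[OF target.bottom_least]) (simp add: carrier_target)

lemma complete_boolean_lattice_target: "complete_boolean_lattice M"
proof
  show "x \<sqinter>\<^bsub>M\<^esub> (y \<squnion>\<^bsub>M\<^esub> z) = (x \<sqinter>\<^bsub>M\<^esub> y) \<squnion>\<^bsub>M\<^esub> (x \<sqinter>\<^bsub>M\<^esub> z)"
    if "x \<in> carrier M" "y \<in> carrier M" "z \<in> carrier M" for x y z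
    using that unfolding carrier_target
    by (elim imageE) (simp add: join_image meet_image distributive)
  show "\<exists>y\<in>carrier M. x \<sqinter>\<^bsub>M\<^esub> y = \<bottom>\<^bsub>M\<^esub> \<and> x \<squnion>\<^bsub>M\<^esub> y = \<top>\<^bsub>M\<^esub>" if x: "x \<in> carrier M" for x
  proof -
    obtain a where a: "a \<in> carrier N" "x = h a" using x by (metis carrier_target imageE)
    then obtain b where "b \<in> carrier N" "a \<sqinter> b = \<bottom>" "a \<squnion> b = \<top>" using complemented by blast
    then show ?thesis
      using a by (intro bexI[of _ "h b"]) (simp_all add: join_image meet_image top_image bottom_image)
  qed
qed

sublocale target: complete_boolean_lattice M
  by (rule complete_boolean_lattice_target)

lemma complement_image:
  assumes a: "a \<in> carrier N"
  shows "complement M (h a) = h (complement N a)"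
proof -
  obtain b where b: "b \<in> carrier N" "a \<sqinter> b = \<bottom>" "a \<squnion> b = \<top>" using complemented a by blast
  then have "complement N a = b" using a by (intro complement_eqI)
  moreover have "complement M (h a) = h b"
    using a b by (intro target.complement_eqI) (simp_all add: join_image meet_image top_image bottom_image)
  ultimately show ?thesis by simp
qed

lemma atoms_target: "atoms M = h ` atoms N"
  unfolding atoms_def carrier_target bottom_image using le_iff h_eq_iff bottom_closed by auto

end

section \<open>Isomorphisms of MT-algebras and their inverses\<close>

locale mt_iso = mt_algebra N + complete_boolean_iso N M h
  for N (structure) and M :: "('c, 'd) mt_scheme" and h +
  assumes box_image: "a \<in> carrier N \<Longrightarrow> \<box>\<^bsub>M\<^esub> (h a) = h (\<box> a)"
begin

lemma mt_algebra_target: "mt_algebra M"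
proof
  show "\<box>\<^bsub>M\<^esub> \<top>\<^bsub>M\<^esub> = \<top>\<^bsub>M\<^esub>"
    by (simp add: top_image box_image box_top)
next
  fix a b assume "a \<in> carrier M" "b \<in> carrier M"
  then show "\<box>\<^bsub>M\<^esub> (a \<sqinter>\<^bsub>M\<^esub> b) = \<box>\<^bsub>M\<^esub> a \<sqinter>\<^bsub>M\<^esub> \<box>\<^bsub>M\<^esub> b"
    unfolding carrier_target by (elim imageE) (simp add: meet_image box_image box_meet box_closed)
next
  fix a assume "a \<in> carrier M"
  then show "\<box>\<^bsub>M\<^esub> a \<in> carrier M" "\<box>\<^bsub>M\<^esub> a \<sqsubseteq>\<^bsub>M\<^esub> a" "\<box>\<^bsub>M\<^esub> a \<sqsubseteq>\<^bsub>M\<^esub> \<box>\<^bsub>M\<^esub> (\<box>\<^bsub>M\<^esub> a)"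
    unfolding carrier_target
    by (elim imageE; simp add: le_iff box_image box_closed box_le box_le_box_box)+
qed

lemma mt_morphism_h: "mt_morphism N M h"
  unfolding mt_morphism_def sup_pres_def inf_pres_def
  by (auto simp: mt_algebra_axioms mt_algebra_target complete_lattice_axioms
      complete_lattice_target sup_image inf_image complement_image box_image box_closed)

text \<open>The locale asks for equality in \<open>box_image\<close>, not just the inequality of a
  morphism, so its assumptions are symmetric. The inverse map is therefore an instance of the same
  locale and inherits the morphism property.\<close>

lemma mt_iso_inverse: "mt_iso M N (inv_into (carrier N) h)"
proof -
  interpret target: mt_algebra M by (rule mt_algebra_target)
  have inv: "inv_into (carrier N) h (h a) = a" if "a \<in> carrier N" for a
    using bij that by (simp add: bij_betw_def)
  show ?thesis
  proof
    show "bij_betw (inv_into (carrier N) h) (carrier M) (carrier N)"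
      using bij by (rule bij_betw_inv_into)
    show "inv_into (carrier N) h a \<sqsubseteq> inv_into (carrier N) h b \<longleftrightarrow> a \<sqsubseteq>\<^bsub>M\<^esub> b"
      if "a \<in> carrier M" "b \<in> carrier M" for a b
      using that unfolding carrier_target by (elim imageE) (simp add: inv le_iff)
    show "\<box> (inv_into (carrier N) h a) = inv_into (carrier N) h (\<box>\<^bsub>M\<^esub> a)"
      if "a \<in> carrier M" for a
      using that unfolding carrier_target by (elim imageE) (simp add: inv box_image box_closed)
  qed (rule eq_is_equal)
qed

lemma mt_isomorphic: "N \<cong>\<^sub>M\<^sub>T M"
proof -
  interpret inverse: mt_iso M N "inv_into (carrier N) h" by (rule mt_iso_inverse)
  show ?thesis
    unfolding mt_isomorphic_def
    using mt_morphism_h inverse.mt_morphism_h bij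
    by (intro exI[of _ h] exI[of _ "inv_into (carrier N) h"])
      (auto simp: bij_betw_def f_inv_into_f)
qed

lemma open_elems_target: "open_elems M = h ` open_elems N"
  unfolding open_elems_def carrier_target using box_image box_closed h_eq_iff by auto

end

section \<open>Homeomorphisms between spaces of atoms\<close>

lemma homeomorphic_mapI:
  assumes bij: "bij_betw f (topspace X) (topspace Y)"
    and opens: "\<And>U. U \<subseteq> topspace X \<Longrightarrow> openin Y (f ` U) \<longleftrightarrow> openin X U"
  shows "homeomorphic_map X Y f"
proof (rule bijective_open_imp_homeomorphic_map)
  show "continuous_map X Y f"
    unfolding continuous_map_def
  proof (intro conjI allI impI)
    fix V assume V: "openin Y V"
    \<comment> \<open>Surjectivity makes \<open>V\<close> the image of its own preimage, so the
      assumption about images also decides whether preimages are open.\<close>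
    have "f ` {x \<in> topspace X. f x \<in> V} = V"
      using bij openin_subset[OF V] by (auto simp: bij_betw_def)
    then show "openin X {x \<in> topspace X. f x \<in> V}"
      using V opens[of "{x \<in> topspace X. f x \<in> V}"] by auto
  qed (use bij in \<open>auto simp: bij_betw_def\<close>)
  show "open_map X Y f"
    using opens by (auto simp: open_map_def openin_subset)
qed (use bij in \<open>auto simp: bij_betw_def\<close>)

text \<open>The top element is open and lies above every atom, so the set of all atoms is itself
  open.\<close>

lemma (in mt_algebra) topspace_atom_space: "topspace (atom_space M) = atoms M"
proof
  have "atoms M = {x \<in> atoms M. x \<sqsubseteq> \<top>}" by (auto simp: atoms_def)
  moreover have "\<top> \<in> open_elems M" by (simp add: open_elems_def box_top)
  ultimately have "openin (atom_space M) (atoms M)" unfolding openin_atom_space by blast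
  then show "atoms M \<subseteq> topspace (atom_space M)" by (rule openin_subset)
  show "topspace (atom_space M) \<subseteq> atoms M" by (auto simp: topspace_def openin_atom_space)
qed

text \<open>An order isomorphism carries atoms onto atoms, and commuting with the box carries open
  elements onto open elements; the open sets they cut out thus correspond.\<close>

lemma (in mt_iso) homeomorphic_map_atom_space:
  "homeomorphic_map (atom_space N) (atom_space M) h"
proof -
  interpret target: mt_algebra M by (rule mt_algebra_target)
  have atoms: "atoms N \<subseteq> carrier N" and opens: "open_elems N \<subseteq> carrier N"
    by (auto simp: atoms_def open_elems_def)
  have inj: "inj_on h (atoms N)"
    using bij atoms by (auto simp: bij_betw_def inj_on_subset)
  have below: "{y \<in> atoms M. y \<sqsubseteq>\<^bsub>M\<^esub> h u} = h ` {x \<in> atoms N. x \<sqsubseteq> u}" if "u \<in> carrier N" for u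
    using that atoms le_iff by (auto simp: atoms_target)
  show ?thesis
  proof (rule homeomorphic_mapI)
    show "bij_betw h (topspace (atom_space N)) (topspace (atom_space M))"
      using inj by (simp add: topspace_atom_space target.topspace_atom_space atoms_target bij_betw_def)
    fix U assume "U \<subseteq> topspace (atom_space N)"
    then have U: "U \<subseteq> atoms N" by (simp add: topspace_atom_space)
    have "openin (atom_space M) (h ` U) \<longleftrightarrow>
        (\<exists>u\<in>open_elems N. h ` U = {y \<in> atoms M. y \<sqsubseteq>\<^bsub>M\<^esub> h u})"
      by (simp add: target.openin_atom_space open_elems_target)
    also have "\<dots> \<longleftrightarrow> (\<exists>u\<in>open_elems N. h ` U = h ` {x \<in> atoms N. x \<sqsubseteq> u})"
      by (intro bex_cong HOL.refl) (simp only: below[OF subsetD[OF opens]])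
    \<comment> \<open>Both sides are images of sets of atoms, on which \<open>h\<close> is
      injective.\<close>
    also have "\<dots> \<longleftrightarrow> (\<exists>u\<in>open_elems N. U = {x \<in> atoms N. x \<sqsubseteq> u})"
      using inj U by (intro bex_cong HOL.refl inj_on_image_eq_iff) auto
    finally show "openin (atom_space M) (h ` U) \<longleftrightarrow> openin (atom_space N) U"
      by (simp add: openin_atom_space)
  qed
qed


section \<open>The MT-algebra of a topological space\<close>

lemma carrier_powerset_mt [simp]: "carrier (powerset_mt X) = Pow (topspace X)"
  and le_powerset_mt [simp]: "le (powerset_mt X) = (\<subseteq>)"
  and eq_powerset_mt [simp]: "eq (powerset_mt X) = (=)"
  and box_powerset_mt [simp]: "\<box>\<^bsub>powerset_mt X\<^esub> A = X interior_of A"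
  by (simp_all add: powerset_mt_def)

lemma partial_order_powerset_mt: "partial_order (powerset_mt X)"
  by standard auto

lemma lub_powerset_mt:
  "\<A> \<subseteq> Pow (topspace X) \<Longrightarrow> least (powerset_mt X) (\<Union>\<A>) (Upper (powerset_mt X) \<A>)"
  by (fastforce intro!: least_UpperI simp: Upper_def)

text \<open>Intersecting with the whole space matters for the empty family, whose meet is
  \<open>topspace X\<close> and not the universe of the type.\<close>

lemma glb_powerset_mt:
  "\<A> \<subseteq> Pow (topspace X) \<Longrightarrow>
     greatest (powerset_mt X) (topspace X \<inter> \<Inter>\<A>) (Lower (powerset_mt X) \<A>)"
  by (fastforce intro!: greatest_LowerI simp: Lower_def)

lemma complete_lattice_powerset_mt: "Complete_Lattice.complete_lattice (powerset_mt X)"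
  by (rule partial_order.complete_latticeI[OF partial_order_powerset_mt])
    (unfold carrier_powerset_mt, (blast intro: lub_powerset_mt glb_powerset_mt)+)

lemma sup_powerset_mt:
  assumes "\<A> \<subseteq> Pow (topspace X)"
  shows "\<Squnion>\<^bsub>powerset_mt X\<^esub> \<A> = \<Union>\<A>"
proof -
  interpret Complete_Lattice.complete_lattice "powerset_mt X" by (rule complete_lattice_powerset_mt)
  show ?thesis
    using least_unique[OF sup_lub lub_powerset_mt] assms by simp
qed

lemma inf_powerset_mt:
  assumes "\<A> \<subseteq> Pow (topspace X)"
  shows "\<Sqinter>\<^bsub>powerset_mt X\<^esub> \<A> = topspace X \<inter> \<Inter>\<A>"
proof -
  interpret Complete_Lattice.complete_lattice "powerset_mt X" by (rule complete_lattice_powerset_mt)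
  show ?thesis
    using greatest_unique[OF inf_glb glb_powerset_mt] assms by simp
qed

lemma join_powerset_mt [simp]:
  "\<lbrakk>A \<subseteq> topspace X; B \<subseteq> topspace X\<rbrakk> \<Longrightarrow> A \<squnion>\<^bsub>powerset_mt X\<^esub> B = A \<union> B"
  by (simp add: join_def sup_powerset_mt)

lemma meet_powerset_mt [simp]:
  "\<lbrakk>A \<subseteq> topspace X; B \<subseteq> topspace X\<rbrakk> \<Longrightarrow> A \<sqinter>\<^bsub>powerset_mt X\<^esub> B = A \<inter> B"
  by (auto simp: meet_def inf_powerset_mt)

lemma top_powerset_mt [simp]: "\<top>\<^bsub>powerset_mt X\<^esub> = topspace X"
proof -
  interpret Complete_Lattice.complete_lattice "powerset_mt X" by (rule complete_lattice_powerset_mt)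
  show ?thesis
    using top_closed top_higher[of "topspace X"] by simp
qed

lemma bottom_powerset_mt [simp]: "\<bottom>\<^bsub>powerset_mt X\<^esub> = {}"
proof -
  interpret Complete_Lattice.complete_lattice "powerset_mt X" by (rule complete_lattice_powerset_mt)
  show ?thesis
    using bottom_lower[of "{}"] by simp
qed

lemma mt_algebra_powerset_mt: "mt_algebra (powerset_mt X)"
proof -
  interpret Complete_Lattice.complete_lattice "powerset_mt X" by (rule complete_lattice_powerset_mt)
  show ?thesis
  proof
    show "\<exists>B\<in>carrier (powerset_mt X). A \<sqinter>\<^bsub>powerset_mt X\<^esub> B = \<bottom>\<^bsub>powerset_mt X\<^esub> \<and>
        A \<squnion>\<^bsub>powerset_mt X\<^esub> B = \<top>\<^bsub>powerset_mt X\<^esub>" if "A \<in> carrier (powerset_mt X)" for A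
      using that by (intro bexI[of _ "topspace X - A"]) auto
  qed (auto simp: interior_of_subset_topspace interior_of_Int le_infI1 Int_Un_distrib
      interior_of_subset[THEN subsetD])
qed

lemma complement_powerset_mt [simp]:
  assumes "A \<subseteq> topspace X"
  shows "complement (powerset_mt X) A = topspace X - A"
proof -
  interpret mt_algebra "powerset_mt X" by (rule mt_algebra_powerset_mt)
  show ?thesis using assms by (intro complement_eqI) auto
qed

lemma open_elems_powerset_mt: "open_elems (powerset_mt X) = {U. openin X U}"
  by (auto simp: open_elems_def openin_subset interior_of_eq eq_commute[of _ "X interior_of _"]
      dest: openin_subset)

text \<open>The complement of the interior of the complement is the closure, so the fixed points of
  the diamond are the sets equal to their closure.\<close>

lemma closed_elems_powerset_mt: "closed_elems (powerset_mt X) = {C. closedin X C}"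
proof -
  have "A = \<diamond>\<^bsub>powerset_mt X\<^esub> A \<longleftrightarrow> closedin X A" if "A \<subseteq> topspace X" for A
    using that by (simp add: mt_diamond_def interior_of_subset_topspace
        interior_of_complement double_diff closure_of_subset_topspace closure_of_eq eq_commute[of A])
  then show ?thesis
    by (auto simp: closed_elems_def dest: closedin_subset)
qed

lemma atoms_powerset_mt: "atoms (powerset_mt X) = (\<lambda>x. {x}) ` topspace X"
proof (intro Set.set_eqI iffI)
  fix A assume A: "A \<in> atoms (powerset_mt X)"
  then obtain x where "x \<in> A" "A \<subseteq> topspace X" by (auto simp: atoms_def)
  \<comment> \<open>The singleton is nonempty and lies below \<open>A\<close>, so minimality of the
    atom forces equality.\<close>
  moreover have "{x} = A"
    using A \<open>x \<in> A\<close> \<open>A \<subseteq> topspace X\<close> by (auto simp: atoms_def dest!: bspec[of _ _ "{x}"])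
  ultimately show "A \<in> (\<lambda>x. {x}) ` topspace X" by auto
qed (auto simp: atoms_def)

text \<open>The atoms are the singletons, and those below an open set are exactly the singletons of
  its points.\<close>

lemma homeomorphic_map_atom_space_powerset_mt:
  "homeomorphic_map X (atom_space (powerset_mt X)) (\<lambda>x. {x})"
proof -
  interpret mt_algebra "powerset_mt X" by (rule mt_algebra_powerset_mt)
  show ?thesis
  proof (rule homeomorphic_mapI)
    show "bij_betw (\<lambda>x. {x}) (topspace X) (topspace (atom_space (powerset_mt X)))"
      by (simp add: topspace_atom_space atoms_powerset_mt bij_betw_def)
    fix U assume U: "U \<subseteq> topspace X"
    have "(\<lambda>x. {x}) ` U = {x \<in> atoms (powerset_mt X). x \<sqsubseteq>\<^bsub>powerset_mt X\<^esub> V} \<longleftrightarrow> U = V"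
      if "openin X V" for V
    proof -
      have "{x \<in> atoms (powerset_mt X). x \<sqsubseteq>\<^bsub>powerset_mt X\<^esub> V} = (\<lambda>x. {x}) ` V"
        using openin_subset[OF that] by (auto simp: atoms_powerset_mt)
      then show ?thesis by (simp add: inj_image_eq_iff)
    qed
    then show "openin (atom_space (powerset_mt X)) ((\<lambda>x. {x}) ` U) \<longleftrightarrow> openin X U"
      by (auto simp: openin_atom_space open_elems_powerset_mt)
  qed
qed


section \<open>Regular opens of the filter space\<close>

text \<open>Both Wallman constructions thus start from the same filters: the points of the classical
  one are the maximal elements of the poset that carries the regular open sets.\<close>

lemma closed_elems_lattice_powerset_mt:
  "closed_elems_lattice (powerset_mt X) = closed_set_lattice X"
  by (simp add: closed_elems_lattice_def closed_set_lattice_def closed_elems_powerset_mt)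

section \<open>Maximal filters of closed sets and the regular open sets they determine\<close>

lemma wallman_points_subset: "wallman_points X \<subseteq> proper_filters (closed_set_lattice X)"
  by (auto simp: wallman_points_def maximal_filters_def)

text \<open>Choice enters here: Zorn's lemma is applied to the proper filters above
  \<open>F\<close>, where the union of a nonempty chain is an upper bound.\<close>

lemma proper_filter_le_wallman_point:
  assumes F: "F \<in> proper_filters (closed_set_lattice X)"
  obtains W where "W \<in> wallman_points X" "F \<subseteq> W"
proof -
  let ?A = "{G \<in> proper_filters (closed_set_lattice X). F \<subseteq> G}"
  have "\<exists>W\<in>?A. \<forall>G\<in>?A. W \<subseteq> G \<longrightarrow> G = W"
  proof (rule subset_Zorn_nonempty)
    show "?A \<noteq> {}" using F by auto
    fix \<C> assume ne: "\<C> \<noteq> {}" and chain: "subset.chain ?A \<C>"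
    have sub: "\<And>G. G \<in> \<C> \<Longrightarrow> G \<in> proper_filters (closed_set_lattice X) \<and> F \<subseteq> G"
      using chain by (auto simp: subset_chain_def)
    note filt = sub[unfolded proper_filters_closed_set_lattice]
    \<comment> \<open>By comparability in the chain, \<open>A\<close> and \<open>B\<close> already
      lie in one common filter.\<close>
    have "A \<inter> B \<in> \<Union>\<C>" if AB: "A \<in> \<Union>\<C>" "B \<in> \<Union>\<C>" for A B
    proof -
      obtain G H where GH: "G \<in> \<C>" "A \<in> G" "H \<in> \<C>" "B \<in> H" using AB by blast
      then have "G \<subseteq> H \<or> H \<subseteq> G" using chain by (auto simp: subset_chain_def)
      then obtain K where "K \<in> \<C>" "A \<in> K" "B \<in> K" using GH by blast
      then show ?thesis using filt by blast
    qed
    moreover have "B \<in> \<Union>\<C>" if "A \<in> \<Union>\<C>" "closedin X B" "A \<subseteq> B" for A B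
      using that filt by blast
    moreover have "\<Union>\<C> \<subseteq> {C. closedin X C}" "\<Union>\<C> \<noteq> {}" "{} \<notin> \<Union>\<C>" "F \<subseteq> \<Union>\<C>"
      using filt ne by blast+
    ultimately show "\<Union>\<C> \<in> ?A"
      by (simp add: proper_filters_closed_set_lattice)
  qed
  then obtain W where W: "W \<in> proper_filters (closed_set_lattice X)" "F \<subseteq> W"
    and max: "\<And>G. \<lbrakk>G \<in> proper_filters (closed_set_lattice X); F \<subseteq> G; W \<subseteq> G\<rbrakk> \<Longrightarrow> G = W"
    by auto
  \<comment> \<open>Maximality above \<open>F\<close> is maximality outright, since every filter
    containing \<open>W\<close> contains \<open>F\<close>.\<close>
  have "W \<in> wallman_points X"
    using W max by (auto simp: wallman_points_def maximal_filters_def)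
  then show ?thesis using W that by blast
qed

lemma wallman_point_maximal:
  "\<lbrakk>W \<in> wallman_points X; F \<in> proper_filters (closed_set_lattice X); W \<subseteq> F\<rbrakk> \<Longrightarrow> F = W"
  by (simp add: wallman_points_def maximal_filters_def)

text \<open>If \<open>C\<close> meets every member of \<open>W\<close>, then \<open>W\<close> and
  \<open>C\<close> together generate a proper filter, and maximality puts \<open>C\<close> into
  \<open>W\<close>. This links the disjointness condition in \<open>wallman_sigma\<close> with
  membership in maximal filters.\<close>

lemma wallman_point_mem_iff:
  assumes W: "W \<in> wallman_points X" and C: "closedin X C"
  shows "C \<in> W \<longleftrightarrow> (\<forall>A\<in>W. C \<inter> A \<noteq> {})"
proof -
  have Wp: "W \<in> proper_filters (closed_set_lattice X)" using W wallman_points_subset by blast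
  note Wp' = Wp[unfolded proper_filters_closed_set_lattice]
  show ?thesis
  proof
    show "\<forall>A\<in>W. C \<inter> A \<noteq> {}" if "C \<in> W" using Wp' that by metis
    assume meets: "\<forall>A\<in>W. C \<inter> A \<noteq> {}"
    \<comment> \<open>The filter generated by \<open>W\<close> and \<open>C\<close>.\<close>
    define G where "G = {B. closedin X B \<and> (\<exists>A\<in>W. C \<inter> A \<subseteq> B)}"
    have "A \<inter> B \<in> G" if AB: "A \<in> G" "B \<in> G" for A B
    proof -
      obtain A' B' where "A' \<in> W" "C \<inter> A' \<subseteq> A" "B' \<in> W" "C \<inter> B' \<subseteq> B"
        using AB by (auto simp: G_def)
      moreover have "A' \<inter> B' \<in> W" using Wp' calculation by blast
      moreover have "C \<inter> (A' \<inter> B') \<subseteq> A \<inter> B" using calculation by blast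
      ultimately show ?thesis using AB unfolding G_def by blast
    qed
    moreover have "B \<in> G" if "A \<in> G" "closedin X B" "A \<subseteq> B" for A B
      using that unfolding G_def by blast
    moreover have "G \<subseteq> {B. closedin X B}" by (auto simp: G_def)
    moreover have "{} \<notin> G" using meets by (auto simp: G_def)
    moreover have "W \<subseteq> G" "C \<in> G" using Wp' C by (auto simp: G_def)
    ultimately have "G \<in> proper_filters (closed_set_lattice X)"
      unfolding proper_filters_closed_set_lattice by blast
    then show "C \<in> W" using wallman_point_maximal[OF W] \<open>W \<subseteq> G\<close> \<open>C \<in> G\<close> by blast
  qed
qed

text \<open>This is the largest upset of proper filters all of whose maximal members lie in
  \<open>S\<close>.\<close>

definition filter_hull :: "'a topology \<Rightarrow> 'a set set set \<Rightarrow> 'a set set set" where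
  "filter_hull X S =
     {F \<in> proper_filters (closed_set_lattice X). \<forall>W\<in>wallman_points X. F \<subseteq> W \<longrightarrow> W \<in> S}"

text \<open>A maximal filter is the only maximal filter above itself, so for it membership in the
  hull is membership in \<open>S\<close>.\<close>

lemma filter_hull_Int_wallman_points:
  "S \<subseteq> wallman_points X \<Longrightarrow> filter_hull X S \<inter> wallman_points X = S"
  using wallman_points_subset wallman_point_maximal unfolding filter_hull_def by blast

text \<open>Suppose every filter above \<open>F\<close> lies below a member of the hull. For a
  maximal \<open>W\<close> above \<open>F\<close> that member must be \<open>W\<close> itself, so
  \<open>W\<close> belongs to \<open>S\<close>; hence \<open>F\<close> is in the hull.\<close>

lemma filter_hull_regular_open:
  "filter_hull X S \<in> carrier (wallman_boolean (powerset_mt X))"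
proof -
  have "F \<in> filter_hull X S"
    if F: "F \<in> proper_filters (closed_set_lattice X)"
      and dense: "\<forall>G\<in>proper_filters (closed_set_lattice X). F \<subseteq> G \<longrightarrow> (\<exists>H\<in>filter_hull X S. G \<subseteq> H)"
    for F
  proof -
    have "W \<in> S" if W: "W \<in> wallman_points X" "F \<subseteq> W" for W
    proof -
      have "W \<in> proper_filters (closed_set_lattice X)"
        using W(1) wallman_points_subset by (rule rev_subsetD)
      then obtain H where H: "H \<in> filter_hull X S" "W \<subseteq> H"
        using dense W(2) by blast
      then have "H = W"
        using wallman_point_maximal[OF W(1), of H] by (simp add: filter_hull_def)
      then show ?thesis using H(1) W(1) by (simp add: filter_hull_def)
    qed
    then show ?thesis using F by (simp add: filter_hull_def)
  qed
  moreover have "G \<in> filter_hull X S"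
    if "F \<in> filter_hull X S" "G \<in> proper_filters (closed_set_lattice X)" "F \<subseteq> G" for F G
    using that unfolding filter_hull_def by blast
  moreover have "filter_hull X S \<subseteq> proper_filters (closed_set_lattice X)"
    by (auto simp: filter_hull_def)
  ultimately show ?thesis
    unfolding carrier_regular_opens_upset_topology openin_upset_topology
      closed_elems_lattice_powerset_mt
    by blast
qed

text \<open>One inclusion holds because \<open>U\<close> is an upset. For the other, each filter
  above a member \<open>F\<close> of the hull extends to a maximal one, which lies in
  \<open>U\<close>; regularity then puts \<open>F\<close> into \<open>U\<close>.\<close>

lemma filter_hull_regular_open_eq:
  assumes "U \<in> carrier (wallman_boolean (powerset_mt X))"
  shows "filter_hull X (U \<inter> wallman_points X) = U"
proof -
  let ?P = "proper_filters (closed_set_lattice X)"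
  have U: "U \<subseteq> ?P" "\<forall>F\<in>U. \<forall>G\<in>?P. F \<subseteq> G \<longrightarrow> G \<in> U"
    and reg: "U = {F \<in> ?P. \<forall>G\<in>?P. F \<subseteq> G \<longrightarrow> (\<exists>H\<in>U. G \<subseteq> H)}"
    using assms
    unfolding carrier_regular_opens_upset_topology openin_upset_topology
      closed_elems_lattice_powerset_mt
    by (fact conjunct1[THEN conjunct1] conjunct1[THEN conjunct2] conjunct2)+
  show ?thesis
  proof
    show "U \<subseteq> filter_hull X (U \<inter> wallman_points X)"
      using U wallman_points_subset unfolding filter_hull_def by blast
    show "filter_hull X (U \<inter> wallman_points X) \<subseteq> U"
    proof
      fix F assume F: "F \<in> filter_hull X (U \<inter> wallman_points X)"
      have "\<exists>H\<in>U. G \<subseteq> H" if "G \<in> ?P" "F \<subseteq> G" for G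
      proof -
        obtain W where "W \<in> wallman_points X" "G \<subseteq> W"
          using proper_filter_le_wallman_point \<open>G \<in> ?P\<close> .
        then show ?thesis using F \<open>F \<subseteq> G\<close> unfolding filter_hull_def by blast
      qed
      then show "F \<in> U" using F by (subst reg) (simp add: filter_hull_def)
    qed
  qed
qed

text \<open>The condition in \<open>wallman_sigma\<close> ranges over all filters above
  \<open>F\<close>, the hull only over the maximal ones. The former restricts to the latter by
  \<open>wallman_point_mem_iff\<close>; conversely, a filter \<open>G\<close> is enlarged to a
  maximal one, which contains \<open>C\<close> and every member of \<open>G\<close>.\<close>

lemma wallman_sigma_eq_filter_hull:
  assumes C: "closedin X C"
  shows "wallman_sigma (powerset_mt X) C = filter_hull X {F \<in> wallman_points X. C \<in> F}"
proof -
  let ?P = "proper_filters (closed_set_lattice X)"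
  have "wallman_sigma (powerset_mt X) C = {F \<in> ?P. \<forall>G\<in>?P. F \<subseteq> G \<longrightarrow> (\<forall>B\<in>G. C \<inter> B \<noteq> {})}"
  proof -
    \<comment> \<open>Members of a filter are closed, hence subsets of the space, where the lattice
      meet is intersection.\<close>
    have "C \<sqinter>\<^bsub>powerset_mt X\<^esub> B = C \<inter> B" if "G \<in> ?P" "B \<in> G" for G B
    proof -
      have "closedin X B" using that by (auto simp: proper_filters_closed_set_lattice)
      then show ?thesis using C by (simp add: closedin_subset)
    qed
    then show ?thesis
      unfolding wallman_sigma_def closed_elems_lattice_powerset_mt by auto
  qed
  also have "\<dots> = filter_hull X {F \<in> wallman_points X. C \<in> F}"
  proof (intro Set.set_eqI iffI)
    fix F assume "F \<in> {F \<in> ?P. \<forall>G\<in>?P. F \<subseteq> G \<longrightarrow> (\<forall>B\<in>G. C \<inter> B \<noteq> {})}"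
    then have F: "F \<in> ?P" and meets: "\<And>G B. \<lbrakk>G \<in> ?P; F \<subseteq> G; B \<in> G\<rbrakk> \<Longrightarrow> C \<inter> B \<noteq> {}"
      by simp_all
    have "C \<in> W" if "W \<in> wallman_points X" "F \<subseteq> W" for W
      using meets[OF subsetD[OF wallman_points_subset]] that wallman_point_mem_iff[OF _ C] by simp
    then show "F \<in> filter_hull X {F \<in> wallman_points X. C \<in> F}"
      using F by (simp add: filter_hull_def)
  next
    fix F assume F: "F \<in> filter_hull X {F \<in> wallman_points X. C \<in> F}"
    have "C \<inter> B \<noteq> {}" if G: "G \<in> ?P" "F \<subseteq> G" "B \<in> G" for G B
    proof -
      obtain W where W: "W \<in> wallman_points X" "G \<subseteq> W"
        using proper_filter_le_wallman_point G(1) .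
      then have "C \<in> W" using F G(2) by (auto simp: filter_hull_def)
      then show ?thesis using subsetD[OF W(2) G(3)] wallman_point_mem_iff[OF W(1) C] by simp
    qed
    then show "F \<in> {F \<in> ?P. \<forall>G\<in>?P. F \<subseteq> G \<longrightarrow> (\<forall>B\<in>G. C \<inter> B \<noteq> {})}"
      using F by (simp add: filter_hull_def)
  qed
  finally show ?thesis .
qed

text \<open>The inverse of the hull restricts a regular open set to the maximal filters it
  contains.\<close>

lemma filter_hull_complete_boolean_iso:
  "complete_boolean_iso (powerset_mt (wallman_space X)) (wallman_boolean (powerset_mt X))
     (filter_hull X)"
proof -
  interpret mt_algebra "powerset_mt (wallman_space X)" by (rule mt_algebra_powerset_mt)
  show ?thesis
  proof
    show "bij_betw (filter_hull X) (carrier (powerset_mt (wallman_space X)))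
        (carrier (wallman_boolean (powerset_mt X)))"
      by (rule bij_betw_byWitness[where f' = "\<lambda>U. U \<inter> wallman_points X"])
        (auto simp: topspace_wallman_space filter_hull_Int_wallman_points
          filter_hull_regular_open_eq filter_hull_regular_open)
  next
    fix S T
    assume "S \<in> carrier (powerset_mt (wallman_space X))" "T \<in> carrier (powerset_mt (wallman_space X))"
    then have "filter_hull X S \<inter> wallman_points X = S" "filter_hull X T \<inter> wallman_points X = T"
      by (simp_all add: topspace_wallman_space filter_hull_Int_wallman_points)
    \<comment> \<open>The hull is monotone, and intersecting with the maximal filters recovers its
      argument.\<close>
    then have "filter_hull X S \<subseteq> filter_hull X T \<longleftrightarrow> S \<subseteq> T"
      unfolding filter_hull_def by blast
    then show "filter_hull X S \<sqsubseteq>\<^bsub>wallman_boolean (powerset_mt X)\<^esub> filter_hull X T \<longleftrightarrow>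
        S \<sqsubseteq>\<^bsub>powerset_mt (wallman_space X)\<^esub> T"
      by (simp add: regular_opens_def)
  qed (simp add: regular_opens_def)
qed

text \<open>Closed sets of the Wallman space are the intersections of basic closed sets. The hull
  turns basic closed sets into values of \<open>wallman_sigma\<close> and preserves arbitrary
  meets.\<close>

lemma wallman_closed_powerset_mt:
  "wallman_closed (powerset_mt X) = filter_hull X ` {K. closedin (wallman_space X) K}"
proof -
  interpret complete_boolean_iso "powerset_mt (wallman_space X)"
    "wallman_boolean (powerset_mt X)" "filter_hull X"
    by (rule filter_hull_complete_boolean_iso)
  define base where "base C = {F \<in> wallman_points X. C \<in> F}" for C
  have inf: "\<Sqinter>\<^bsub>wallman_boolean (powerset_mt X)\<^esub> (wallman_sigma (powerset_mt X) ` \<C>) =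
      filter_hull X {F \<in> wallman_points X. \<C> \<subseteq> F}"
    if \<C>: "\<C> \<subseteq> {C. closedin X C}" for \<C>
  proof -
    have sub: "base ` \<C> \<subseteq> Pow (topspace (wallman_space X))"
      by (auto simp: base_def topspace_wallman_space)
    have "wallman_sigma (powerset_mt X) ` \<C> = filter_hull X ` base ` \<C>"
      unfolding image_image using \<C>
      by (intro image_cong) (auto simp: base_def wallman_sigma_eq_filter_hull)
    then have "\<Sqinter>\<^bsub>wallman_boolean (powerset_mt X)\<^esub> (wallman_sigma (powerset_mt X) ` \<C>) =
        filter_hull X (\<Sqinter>\<^bsub>powerset_mt (wallman_space X)\<^esub> (base ` \<C>))"
      using sub by (simp add: inf_image)
    \<comment> \<open>For empty \<open>\<C>\<close> both sides are the set of all maximal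
      filters.\<close>
    also have "\<Sqinter>\<^bsub>powerset_mt (wallman_space X)\<^esub> (base ` \<C>) = {F \<in> wallman_points X. \<C> \<subseteq> F}"
      using sub by (auto simp: inf_powerset_mt topspace_wallman_space base_def)
    finally show ?thesis .
  qed
  have "wallman_closed (powerset_mt X) =
      {\<Sqinter>\<^bsub>wallman_boolean (powerset_mt X)\<^esub> (wallman_sigma (powerset_mt X) ` \<C>) | \<C>.
        \<C> \<subseteq> {C. closedin X C}}"
    unfolding wallman_closed_def closed_elems_powerset_mt by (auto simp: subset_image_iff)
  also have "\<dots> = filter_hull X ` {K. closedin (wallman_space X) K}"
    unfolding closedin_wallman_space using inf by auto
  finally show ?thesis .
qed

lemma wallman_open_powerset_mt:
  "wallman_open (powerset_mt X) = filter_hull X ` {U. openin (wallman_space X) U}"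
proof -
  interpret complete_boolean_iso "powerset_mt (wallman_space X)"
    "wallman_boolean (powerset_mt X)" "filter_hull X"
    by (rule filter_hull_complete_boolean_iso)
  let ?Y = "wallman_space X"
  have complement: "complement (wallman_boolean (powerset_mt X)) (filter_hull X K) =
      filter_hull X (topspace ?Y - K)" if "closedin ?Y K" for K
    using complement_image[of K] closedin_subset[OF that] by simp
  have "wallman_open (powerset_mt X) = (\<lambda>K. filter_hull X (topspace ?Y - K)) ` {K. closedin ?Y K}"
    unfolding wallman_open_def wallman_closed_powerset_mt image_image
    by (intro image_cong HOL.refl) (simp add: complement)
  also have "\<dots> = filter_hull X ` (\<lambda>K. topspace ?Y - K) ` {K. closedin ?Y K}"
    by (simp add: image_image)
  also have "(\<lambda>K. topspace ?Y - K) ` {K. closedin ?Y K} = {U. openin ?Y U}"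
    by (auto simp: image_iff openin_closedin_eq double_diff closedin_subset
        intro!: exI[of _ "topspace ?Y - _"])
  finally show ?thesis .
qed

text \<open>The interior of \<open>S\<close> is the greatest open set inside \<open>S\<close>. The
  hull preserves greatest elements and matches the open elements, so it sends the interior to the
  value that the box picks out by definite description.\<close>

lemma filter_hull_mt_iso:
  "mt_iso (powerset_mt (wallman_space X)) (wallman_mt (powerset_mt X)) (filter_hull X)"
proof -
  let ?Y = "wallman_space X" and ?R = "wallman_boolean (powerset_mt X)"
  interpret mt_algebra "powerset_mt ?Y" by (rule mt_algebra_powerset_mt)
  interpret boolean: complete_boolean_iso "powerset_mt ?Y" ?R "filter_hull X"
    by (rule filter_hull_complete_boolean_iso)
  \<comment> \<open>The two records share carrier, order and equality but have different types, so
    the Boolean isomorphism is passed on through these equations.\<close>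
  have simps: "carrier (wallman_mt (powerset_mt X)) = carrier ?R"
    "le (wallman_mt (powerset_mt X)) = le ?R" "eq (wallman_mt (powerset_mt X)) = eq ?R"
    by (simp_all add: wallman_mt_def regular_opens_def)
  show ?thesis
  proof
    fix S assume "S \<in> carrier (powerset_mt ?Y)"
    then have S: "S \<subseteq> topspace ?Y" by simp
    have "{V \<in> wallman_open (powerset_mt X). V \<subseteq> filter_hull X S} =
        filter_hull X ` {U. openin ?Y U \<and> U \<subseteq> S}"
    proof -
      have "filter_hull X U \<subseteq> filter_hull X S \<longleftrightarrow> U \<subseteq> S" if "openin ?Y U" for U
        using boolean.le_iff[of U S] S openin_subset[OF that] by (simp add: regular_opens_def)
      then show ?thesis unfolding wallman_open_powerset_mt by auto
    qed
    moreover have "greatest (powerset_mt ?Y) (?Y interior_of S) {U. openin ?Y U \<and> U \<subseteq> S}"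
      unfolding greatest_def
      by (auto simp: interior_of_subset interior_of_maximal dest: openin_subset
          interior_of_subset[THEN subsetD] interior_of_maximal[THEN subsetD])
    ultimately have "greatest ?R (filter_hull X (?Y interior_of S))
        {V \<in> wallman_open (powerset_mt X). V \<subseteq> filter_hull X S}"
      using boolean.greatest_image by simp
    then have "(THE U. greatest ?R U {V \<in> wallman_open (powerset_mt X). V \<subseteq> filter_hull X S}) =
        filter_hull X (?Y interior_of S)"
      using boolean.target.greatest_unique by (intro the_equality)
    then show "\<box>\<^bsub>wallman_mt (powerset_mt X)\<^esub> (filter_hull X S) =
        filter_hull X (\<box>\<^bsub>powerset_mt ?Y\<^esub> S)"
      by (simp add: wallman_mt_def)
  qed (use boolean.bij boolean.le_iff boolean.eq_target in \<open>simp_all add: simps\<close>)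
qed

theorem theorem4p12:
  fixes X :: "'a topology"
  assumes "t1_space X"
  shows "powerset_mt (wallman_space X) \<cong>\<^sub>M\<^sub>T wallman_mt (powerset_mt X) \<and>
         wallman_space X homeomorphic_space atom_space (wallman_mt (powerset_mt X))"
proof -
  interpret mt_iso "powerset_mt (wallman_space X)" "wallman_mt (powerset_mt X)" "filter_hull X"
    by (rule filter_hull_mt_iso)
  \<comment> \<open>Points are first replaced by their singletons, the atoms of the powerset, which
    \<open>filter_hull X\<close> then carries to the atoms of the Wallman extension.\<close>
  have "wallman_space X homeomorphic_space atom_space (powerset_mt (wallman_space X))"
    using homeomorphic_map_atom_space_powerset_mt by (rule homeomorphic_map_imp_homeomorphic_space)
  also have "\<dots> homeomorphic_space atom_space (wallman_mt (powerset_mt X))"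
    using homeomorphic_map_atom_space by (rule homeomorphic_map_imp_homeomorphic_space)
  finally show ?thesis using mt_isomorphic by blast
qed

end
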